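(* Let $n=n_1+n_2$ with $n_2\ge n_1\ge 0$, and with $n$ and $n_2-n_1$ even. Then the number $B_n$ of distinct Boolean functions on $n$ variables given by construction (K) with parameters $n_1,n_2$ (every one of which is a bent function) equals $$B_n=(b_{n_2-n_1})^{2^{n_1}}\cdot \widetilde{N}_{n_2}^{\,n_2-n_1},$$ where $b_{k}$ is the number of bent functions on $k$ variables and $\widetilde{N}_{n_2}^{\,n_2-n_1}$ is the number of ordered partitions of $F_2^{n_2}$ into $2^{n_1}$ affine subspaces of dimension $n_2-n_1$.
   Context: $F_2=\{0,1\}$ and $F_2^m$ is the vector space with coordinatewise addition $\oplus$ mod 2. An affine subspace of dimension $k$ is a set $a\oplus S$ with $S$ a $k$-dimensional linear subspace. For $x,u\in F_2^m$, $\langle u,x\rangle=\bigoplus_i u_ix_i$. For a Boolean function $f:F_2^m\to F_2$, its Walsh transform is $W_f(u)=\sum_{x\in F_2^m}(-1)^{\langle u,x\rangle\oplus f(x)}$, and the support of its Walsh spectrum is $\{u: W_f(u)\ne 0\}$. $f$ is bent if $|W_f(u)|=2^{m/2}$ for all $u$; $f$ is plateaued if all its Walsh coefficients lie in $\{0,\pm 2^{k}\}$ for some integer $k$. For $a\in F_2$ write $a^1=a$, $a^0=a\oplus 1$, and for $x,a\in F_2^{m}$ write $x^a=x_1^{a_1}\cdots x_m^{a_m}$ (so $x^a=1$ iff $x=a$). Construction (K) with parameters $n_1,n_2$: choose an ordered partition $\{C_a\}_{a\in F_2^{n_1}}$ of $F_2^{n_2}$ into affine subspaces $C_a$ of dimension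 $n_2-n_1$, and for each $a$ choose a plateaued function $f_a:F_2^{n_2}\to F_2$ whose Walsh spectrum support is exactly $C_a$; then set $f(x,y)=\bigoplus_{a\in F_2^{n_1}} f_a(y)x^a$ for $x\in F_2^{n_1}$, $y\in F_2^{n_2}$. *)

theory Defs
  imports
    "Jordan_Normal_Form.VS_Connect"
    "HOL-Library.Z2"
    "HOL-Library.FuncSet"
    "HOL-Library.Disjoint_Sets"
begin

text \<open>
  The field with two elements is the type \<^typ>\<open>bit\<close>, and the space of binary words of length
  \<open>m\<close> is the carrier \<open>carrier_vec m\<close> inside \<^typ>\<open>bit vec\<close>. Functions on it are extensional, so
  that distinct elements of the function spaces below are distinct as Boolean functions.
\<close>

definition boolean_functions :: "nat \<Rightarrow> (bit vec \<Rightarrow> bit) set" where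
  "boolean_functions m = carrier_vec m \<rightarrow>\<^sub>E UNIV"

definition bit_sign :: "bit \<Rightarrow> int" where
  "bit_sign b = (if b = 0 then 1 else - 1)"

definition walsh :: "nat \<Rightarrow> (bit vec \<Rightarrow> bit) \<Rightarrow> bit vec \<Rightarrow> int" where
  "walsh m f u = (\<Sum>x\<in>carrier_vec m. bit_sign (u \<bullet> x + f x))"

definition walsh_support :: "nat \<Rightarrow> (bit vec \<Rightarrow> bit) \<Rightarrow> bit vec set" where
  "walsh_support m f = {u \<in> carrier_vec m. walsh m f u \<noteq> 0}"

definition bent :: "nat \<Rightarrow> (bit vec \<Rightarrow> bit) \<Rightarrow> bool" where
  "bent m f \<longleftrightarrow> (\<forall>u\<in>carrier_vec m. \<bar>real_of_int (walsh m f u)\<bar> = 2 powr (real m / 2))"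

definition plateaued :: "nat \<Rightarrow> (bit vec \<Rightarrow> bit) \<Rightarrow> bool" where
  "plateaued m f \<longleftrightarrow>
    (\<exists>k::int. \<forall>u\<in>carrier_vec m. real_of_int (walsh m f u) \<in> {0, 2 powi k, - (2 powi k)})"

definition num_bent :: "nat \<Rightarrow> nat" where
  "num_bent k = card {f \<in> boolean_functions k. bent k f}"

definition linear_subspace :: "nat \<Rightarrow> nat \<Rightarrow> bit vec set \<Rightarrow> bool" where
  "linear_subspace m k S \<longleftrightarrow>
    VectorSpace.subspace class_ring S (module_vec TYPE(bit) m) \<and>
    vectorspace.dim class_ring ((module_vec TYPE(bit) m)\<lparr>carrier := S\<rparr>) = k"

definition affine_subspace :: "nat \<Rightarrow> nat \<Rightarrow> bit vec set \<Rightarrow> bool" where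
  "affine_subspace m k A \<longleftrightarrow>
    (\<exists>a\<in>carrier_vec m. \<exists>S. linear_subspace m k S \<and> A = (\<lambda>s. a + s) ` S)"

text \<open>
  An ordered partition is a family of disjoint blocks indexed by \<open>I\<close>; affine subspaces are
  nonempty, so no separate nonemptiness condition on the blocks is needed. A partition of the
  whole space into affine subspaces of dimension \<open>k\<close> has \<open>2 ^ (m - k)\<close> blocks; this is the
  number of positions used when counting ordered partitions.
\<close>

definition ordered_affine_partitions :: "'i set \<Rightarrow> nat \<Rightarrow> nat \<Rightarrow> ('i \<Rightarrow> bit vec set) set" where
  "ordered_affine_partitions I m k =
    {C \<in> I \<rightarrow>\<^sub>E {A. affine_subspace m k A}.
      disjoint_family_on C I \<and> (\<Union>i\<in>I. C i) = carrier_vec m}"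

definition num_ordered_affine_partitions :: "nat \<Rightarrow> nat \<Rightarrow> nat" where
  "num_ordered_affine_partitions m k =
    card (ordered_affine_partitions {..<(2::nat) ^ (m - k)} m k)"

definition bit_pow :: "bit \<Rightarrow> bit \<Rightarrow> bit" where
  "bit_pow b e = (if e = 1 then b else b + 1)"

definition monomial :: "bit vec \<Rightarrow> bit vec \<Rightarrow> bit" where
  "monomial x a = (\<Prod>i<dim_vec x. bit_pow (x $ i) (a $ i))"

definition construction_K :: "nat \<Rightarrow> nat \<Rightarrow> (bit vec \<Rightarrow> bit) set" where
  "construction_K n1 n2 =
    {f \<in> boolean_functions (n1 + n2).
      \<exists>C \<in> ordered_affine_partitions (carrier_vec n1) n2 (n2 - n1).
      \<exists>g :: bit vec \<Rightarrow> bit vec \<Rightarrow> bit.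
        (\<forall>a\<in>carrier_vec n1.
          g a \<in> boolean_functions n2 \<and> plateaued n2 (g a) \<and> walsh_support n2 (g a) = C a) \<and>
        (\<forall>x\<in>carrier_vec n1. \<forall>y\<in>carrier_vec n2.
          f (x @\<^sub>v y) = (\<Sum>a\<in>carrier_vec n1. g a y * monomial x a))}"

end

theory Submission
  imports Defs
begin

text \<open>
  For \<open>x\<close> fixed, \<open>f(x, \<cdot>)\<close> is \<open>f\<^sub>x\<close>, so \<open>W\<^sub>f(u, v)\<close> is the sum over \<open>x\<close> of
  \<open>(-1)\<^bsup>\<langle>u, x\<rangle>\<^esup> W\<^bsub>f\<^sub>x\<^esub>(v)\<close>. Since the supports partition the space, exactly one summand is nonzero, and
  Parseval's identity gives its absolute value; hence \<open>f\<close> is bent. The functions \<open>f\<^sub>x\<close> are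
  determined by \<open>f\<close>, and they determine the partition, so the count reduces to showing that
  the number of plateaued functions with Walsh support a given \<open>k\<close>-dimensional affine subspace
  \<open>A = a + M F\<^sub>2\<^sup>k\<close> (\<open>k\<close> even, \<open>M\<close> injective) is the number of bent functions in \<open>k\<close> variables.

  On \<open>A\<close> the Walsh transform of such a function \<open>g\<close> on \<open>F\<^sub>2\<^sup>m\<close> is
  \<open>W\<^sub>g(a + M z) = 2\<^bsup>m - k/2\<^esup> (-1)\<^bsup>e(z)\<^esup>\<close> for a unique Boolean function \<open>e\<close>, and Fourier inversion reads
  \<open>2\<^bsup>k/2\<^esup> (-1)\<^bsup>g(x)\<^esup> = (-1)\<^bsup>\<langle>a, x\<rangle>\<^esup> W\<^sub>e(M\<^sup>T x)\<close>. As \<open>M\<^sup>T\<close> is surjective, the right-hand side has constant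
  absolute value \<open>2\<^bsup>k/2\<^esup>\<close> precisely when \<open>e\<close> is bent.
\<close>

section \<open>Walsh transform\<close>

lemma UNIV_bit: "(UNIV :: bit set) = {0, 1}"
  using bit_not_zero_iff by blast

lemma card_UNIV_bit: "card (UNIV :: bit set) = 2"
  by (subst UNIV_bit) simp

lemma card_carrier_vec_bit: "card (carrier_vec m :: bit vec set) = 2 ^ m"
proof -
  have fin: "finite (UNIV :: bit set)"
    by (subst UNIV_bit) simp
  have "bij_betw list_of_vec (carrier_vec m :: bit vec set) {xs. set xs \<subseteq> UNIV \<and> length xs = m}"
  proof (rule bij_betw_byWitness[where f' = vec_of_list])
    show "\<forall>v\<in>carrier_vec m. vec_of_list (list_of_vec v) = (v :: bit vec)"
      by (simp add: vec_list)
    show "\<forall>xs\<in>{xs. set xs \<subseteq> UNIV \<and> length xs = m}. list_of_vec (vec_of_list xs) = (xs :: bit list)"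
      by (simp add: list_vec)
    show "list_of_vec ` carrier_vec m \<subseteq> {xs :: bit list. set xs \<subseteq> UNIV \<and> length xs = m}"
      by (simp add: image_subset_iff)
    show "vec_of_list ` {xs :: bit list. set xs \<subseteq> UNIV \<and> length xs = m} \<subseteq> carrier_vec m"
      by (simp add: image_subset_iff carrier_vecI)
  qed
  then have "card (carrier_vec m :: bit vec set) = card {xs :: bit list. set xs \<subseteq> UNIV \<and> length xs = m}"
    by (rule bij_betw_same_card)
  also have "\<dots> = card (UNIV :: bit set) ^ m"
    by (rule card_lists_length_eq[OF fin])
  finally show ?thesis by (simp only: card_UNIV_bit)
qed

lemma finite_carrier_vec_bit [simp]: "finite (carrier_vec m :: bit vec set)"
  by (rule card_ge_0_finite) (simp add: card_carrier_vec_bit)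

section \<open>Signs, addition in characteristic two, and characters\<close>

lemma bit_sign_0 [simp]: "bit_sign 0 = 1"
  by (simp add: bit_sign_def)

lemma bit_sign_1 [simp]: "bit_sign 1 = - 1"
  by (simp add: bit_sign_def)

lemma bit_sign_add: "bit_sign (a + b) = bit_sign a * bit_sign b"
  by (cases a; cases b) simp_all

lemma abs_bit_sign [simp]: "\<bar>bit_sign a\<bar> = 1"
  by (cases a) simp_all

lemma bit_sign_mult_self [simp]: "bit_sign a * bit_sign a = 1"
  by (cases a) simp_all

lemma bit_sign_eq_iff [simp]: "bit_sign a = bit_sign b \<longleftrightarrow> a = b"
  by (cases a; cases b) simp_all

lemma bit_vec_add_self: "x \<in> carrier_vec m \<Longrightarrow> x + x = (0\<^sub>v m :: bit vec)"
  by auto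

lemma bit_vec_add_cancel:
  fixes u v :: "bit vec"
  assumes "u \<in> carrier_vec m" "v \<in> carrier_vec m"
  shows "u + (u + v) = v"
  using assms by (simp add: assoc_add_vec[symmetric, of _ m] bit_vec_add_self)

lemma bit_vec_add_eq_0_iff:
  fixes u v :: "bit vec"
  assumes "u \<in> carrier_vec m" "v \<in> carrier_vec m"
  shows "u + v = 0\<^sub>v m \<longleftrightarrow> u = v"
  using assms bit_vec_add_cancel[of u m v] by (auto simp: bit_vec_add_self)

lemma bit_sign_add_scalar_prod:
  fixes u v x :: "bit vec"
  assumes "u \<in> carrier_vec m" "v \<in> carrier_vec m" "x \<in> carrier_vec m"
  shows "bit_sign ((u + v) \<bullet> x) = bit_sign (u \<bullet> x) * bit_sign (v \<bullet> x)"
  by (simp only: add_scalar_prod_distrib[OF assms] bit_sign_add)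

lemma bit_sign_scalar_prod_add:
  fixes u x y :: "bit vec"
  assumes "u \<in> carrier_vec m" "x \<in> carrier_vec m" "y \<in> carrier_vec m"
  shows "bit_sign (u \<bullet> (x + y)) = bit_sign (u \<bullet> x) * bit_sign (u \<bullet> y)"
  by (simp only: scalar_prod_add_distrib[OF assms] bit_sign_add)

text \<open>If \<open>w\<close> has a coordinate equal to 1, translation by the corresponding unit
  vector permutes the space and flips the sign of every summand, so the sum equals its own
  negative.\<close>

lemma sum_bit_sign_scalar_prod:
  fixes w :: "bit vec"
  assumes w: "w \<in> carrier_vec m"
  shows "(\<Sum>x\<in>carrier_vec m. bit_sign (w \<bullet> x)) = (if w = 0\<^sub>v m then 2 ^ m else 0)"
proof (cases "w = 0\<^sub>v m")
  case True
  then show ?thesis by (simp add: card_carrier_vec_bit)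
next
  case False
  then obtain i where i: "i < m" "w $ i = 1"
    using w by (metis bit_not_zero_iff carrier_vecD eq_vecI index_zero_vec)
  define t where "t x = x + unit_vec m i" for x :: "bit vec"
  have tt: "t (t x) = x" if "x \<in> carrier_vec m" for x
    using that bit_vec_add_cancel[of "unit_vec m i" m x] by (simp add: t_def comm_add_vec[of _ m])
  have "bij_betw t (carrier_vec m) (carrier_vec m)"
    by (rule bij_betw_byWitness[where f' = t]) (auto simp: tt t_def)
  then have "(\<Sum>x\<in>carrier_vec m. bit_sign (w \<bullet> x)) = (\<Sum>x\<in>carrier_vec m. bit_sign (w \<bullet> t x))"
    by (rule sum.reindex_bij_betw[symmetric])
  also have "\<dots> = (\<Sum>x\<in>carrier_vec m. - bit_sign (w \<bullet> x))"
    using w i by (intro sum.cong) (auto simp: t_def bit_sign_scalar_prod_add[of _ m])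
  finally show ?thesis
    using False by (simp add: sum_negf)
qed

section \<open>Fourier inversion and Parseval's identity\<close>

lemma walsh_altdef:
  "walsh m f u = (\<Sum>x\<in>carrier_vec m. bit_sign (u \<bullet> x) * bit_sign (f x))"
  by (simp only: walsh_def bit_sign_add)

lemma sum_bit_sign_scalar_prod_right:
  fixes w :: "bit vec"
  assumes w: "w \<in> carrier_vec m"
  shows "(\<Sum>x\<in>carrier_vec m. bit_sign (x \<bullet> w)) = (if w = 0\<^sub>v m then 2 ^ m else 0)"
  unfolding sum_bit_sign_scalar_prod[OF w, symmetric]
  using w by (intro sum.cong refl arg_cong[of _ _ bit_sign] comm_scalar_prod)

text \<open>After exchanging the sums, orthogonality of characters leaves only the term
  \<open>y = x\<close>.\<close>

lemma walsh_inversion: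
  assumes x: "x \<in> carrier_vec m"
  shows "(\<Sum>u\<in>carrier_vec m. walsh m f u * bit_sign (u \<bullet> x)) = 2 ^ m * bit_sign (f x)"
proof -
  have "(\<Sum>u\<in>carrier_vec m. walsh m f u * bit_sign (u \<bullet> x))
      = (\<Sum>y\<in>carrier_vec m. \<Sum>u\<in>carrier_vec m. bit_sign (u \<bullet> y) * bit_sign (f y) * bit_sign (u \<bullet> x))"
    unfolding walsh_altdef sum_distrib_right by (rule sum.swap)
  also have "\<dots> = (\<Sum>y\<in>carrier_vec m. bit_sign (f y) * (\<Sum>u\<in>carrier_vec m. bit_sign (u \<bullet> (y + x))))"
    unfolding sum_distrib_left
    using x by (intro sum.cong refl) (simp add: bit_sign_scalar_prod_add[of _ m])
  also have "\<dots> = (\<Sum>y\<in>carrier_vec m. if y = x then bit_sign (f y) * 2 ^ m else 0)"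
    using x by (intro sum.cong refl) (simp add: sum_bit_sign_scalar_prod_right bit_vec_add_eq_0_iff)
  finally show ?thesis
    using x by simp
qed

text \<open>Expanding one factor of each square turns the sum over \<open>u\<close> into the
  inversion formula, so each \<open>x\<close> contributes the square of a sign times
  \<open>2 ^ m\<close>.\<close>

lemma walsh_parseval: "(\<Sum>u\<in>carrier_vec m. (walsh m f u)\<^sup>2) = 2 ^ m * 2 ^ m"
proof -
  have "(\<Sum>u\<in>carrier_vec m. (walsh m f u)\<^sup>2)
      = (\<Sum>x\<in>carrier_vec m. bit_sign (f x) * (\<Sum>u\<in>carrier_vec m. walsh m f u * bit_sign (u \<bullet> x)))"
    unfolding power2_eq_square
    \<comment> \<open>Only one of the two factors is expanded; the other must stay intact for the
      inversion formula.\<close>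
    apply (subst (2) walsh_altdef)
    unfolding sum_distrib_left
    by (subst sum.swap) (simp add: mult_ac)
  also have "\<dots> = (\<Sum>x\<in>(carrier_vec m :: bit vec set). 2 ^ m :: int)"
    by (intro sum.cong) (auto simp: walsh_inversion mult.left_commute)
  finally show ?thesis
    by (simp add: card_carrier_vec_bit)
qed

section \<open>Linear subspaces in coordinates\<close>

text \<open>The columns of \<open>M\<close> form a basis of \<open>S\<close>: spanning gives the
  image, independence the trivial kernel. All later arguments use the dimension only through this
  matrix.\<close>

lemma linear_subspace_matrix_image:
  assumes "linear_subspace m k S"
  obtains M where "M \<in> carrier_mat m k" "S = (\<lambda>z. M *\<^sub>v z) ` carrier_vec k"
    "\<forall>z\<in>carrier_vec k. M *\<^sub>v z = 0\<^sub>v m \<longrightarrow> z = 0\<^sub>v k"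
proof -
  interpret V: vec_space "TYPE(bit)" m .
  have sub: "VectorSpace.subspace class_ring S (module_vec TYPE(bit) m)"
    and dim: "vectorspace.dim class_ring ((module_vec TYPE(bit) m)\<lparr>carrier := S\<rparr>) = k"
    using assms by (auto simp: linear_subspace_def)
  interpret W: vectorspace class_ring "V.vs S"
    by (rule V.subspace_is_vs[OF sub])
  have subm: "submodule class_ring S (module_vec TYPE(bit) m)"
    using sub by (simp only: VectorSpace.subspace_def)
  have S: "S \<subseteq> carrier_vec m"
    using subm by (auto simp: submodule_def)
  then have finS: "finite S" by (rule finite_subset) simp
  \<comment> \<open>The finite set \<open>S\<close> spans itself, so a finite basis exists.\<close>
  have "W.fin_dim"
    unfolding W.fin_dim_def using finS W.in_own_span[of S] W.span_is_subset2[of S] by auto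
  then obtain B where B: "finite B" "W.basis B"
    using W.finite_basis_exists by blast
  have cW: "carrier (V.vs S) = S"
    by simp
  have BW: "W.lin_indpt B" "W.span B = S" and BS: "B \<subseteq> S"
    using B(2) unfolding W.basis_def cW by blast+
  have Bc: "B \<subseteq> carrier_vec m" using BS S by blast
  have cardB: "card B = k" using W.dim_basis[OF B] dim by (rule trans[OF sym])
  \<comment> \<open>Independence and span of a subset of \<open>S\<close> are the same in
    \<open>S\<close> as in the ambient space.\<close>
  have li: "V.lin_indpt B"
    using BW(1) V.span_li_not_depend(2)[OF BS subm] by blast
  have span: "V.span B = S"
    using BW(2) V.span_li_not_depend(1)[OF BS subm] by (rule trans[OF sym, rotated])
  obtain bs where bs: "set bs = B" "distinct bs"
    using finite_distinct_list[OF B(1)] by blast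
  have len: "length bs = k" using bs cardB distinct_card by fastforce
  define M where "M = mat_of_cols m bs"
  have M: "M \<in> carrier_mat m k" by (simp add: M_def len carrier_matI)
  have "\<forall>w\<in>set bs. dim_vec w = m"
    using bs(1) Bc by auto
  then have lc: "V.lincomb f B = M *\<^sub>v vec k (\<lambda>i. f (bs ! i))" for f
    using V.lincomb_as_lincomb_list_distinct[of bs f]
      V.lincomb_list_as_mat_mult[of bs "\<lambda>i. f (bs ! i)"] bs Bc
    by (simp add: M_def len)
  \<comment> \<open>Turns a coordinate vector into a coefficient function on basis vectors; the
    index is unique because \<open>bs\<close> is distinct.\<close>
  define coef where "coef z b = z $ (THE i. i < k \<and> bs ! i = b)" for z :: "bit vec" and b
  have coef: "coef z (bs ! i) = z $ i" if "i < k" for z i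
  proof -
    have "(THE j. j < k \<and> bs ! j = bs ! i) = i"
      using that bs(2) len by (auto simp: nth_eq_iff_index_eq)
    then show ?thesis by (simp add: coef_def)
  qed
  have vz: "vec k (\<lambda>i. coef z (bs ! i)) = z" if "z \<in> carrier_vec k" for z
    using that by (auto simp: coef)
  have lz: "M *\<^sub>v z = V.lincomb (coef z) B" if "z \<in> carrier_vec k" for z
    using lc[of "coef z"] vz[OF that] by simp
  have sp: "V.span B = {V.lincomb a B | a. a \<in> B \<rightarrow> UNIV}"
    using V.finite_span[OF B(1)] Bc by simp
  have "S = (\<lambda>z. M *\<^sub>v z) ` carrier_vec k"
  proof
    show "S \<subseteq> (\<lambda>z. M *\<^sub>v z) ` carrier_vec k"
      unfolding span[symmetric] sp by (auto simp: lc)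
    show "(\<lambda>z. M *\<^sub>v z) ` carrier_vec k \<subseteq> S"
      unfolding span[symmetric] sp using lz by auto
  qed
  moreover have "z = 0\<^sub>v k" if z: "z \<in> carrier_vec k" and "M *\<^sub>v z = 0\<^sub>v m" for z
  proof (rule eq_vecI)
    fix i assume "i < dim_vec (0\<^sub>v k :: bit vec)"
    then have i: "i < k" by simp
    then have "bs ! i \<in> B" using bs len by auto
    moreover have "V.lincomb (coef z) B = 0\<^sub>v m" using lz that by simp
    ultimately have "coef z (bs ! i) = 0"
      using li B(1) unfolding V.lin_dep_def by auto
    then show "z $ i = 0\<^sub>v k $ i" using i by (simp add: coef)
  qed (use z in simp)
  ultimately show ?thesis using that M by blast
qed


section \<open>Bent and plateaued functions through integer Walsh values\<close>

lemma bent_iff_abs_walsh: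
  assumes "even k"
  shows "bent k f \<longleftrightarrow> (\<forall>u\<in>carrier_vec k. \<bar>walsh k f u\<bar> = 2 ^ (k div 2))"
proof -
  have "2 powr (real k / 2) = 2 powr (real (k div 2))"
    using assms by (auto simp: real_of_nat_div)
  then have "2 powr (real k / 2) = real_of_int (2 ^ (k div 2))"
    by (simp add: powr_realpow)
  then show ?thesis
    unfolding bent_def by (metis (no_types) of_int_abs of_int_eq_iff)
qed

text \<open>The unknown amplitude \<open>c\<close> of a plateaued function is forced by Parseval:
  its \<open>2 ^ k\<close> nonzero coefficients satisfy
  \<open>2 ^ k * c\<^sup>2 = 2 ^ m * 2 ^ m\<close>.\<close>

lemma plateaued_walsh_support_iff:
  assumes A: "A \<subseteq> carrier_vec m" "card A = 2 ^ k" and k: "even k" "k \<le> m"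
  shows "plateaued m g \<and> walsh_support m g = A \<longleftrightarrow>
    (\<forall>u\<in>A. \<bar>walsh m g u\<bar> = 2 ^ (m - k div 2)) \<and> (\<forall>u\<in>carrier_vec m - A. walsh m g u = 0)"
    (is "?L \<longleftrightarrow> ?R")
proof
  assume L: ?L
  then obtain j :: int where
    j: "\<And>u. u \<in> carrier_vec m \<Longrightarrow> real_of_int (walsh m g u) \<in> {0, 2 powi j, - (2 powi j)}"
    by (auto simp: plateaued_def)
  have sup: "u \<in> A \<longleftrightarrow> u \<in> carrier_vec m \<and> walsh m g u \<noteq> 0" for u
    using L by (auto simp: walsh_support_def)
  have abs_A: "real_of_int \<bar>walsh m g u\<bar> = 2 powi j" if "u \<in> A" for u
    using j[of u] that by (auto simp: sup)
  \<comment> \<open>A point of the support is needed to turn the real amplitude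
    \<open>2 powi j\<close> into an integer.\<close>
  have "A \<noteq> {}" using A(2) by auto
  then obtain u0 where u0: "u0 \<in> A" by blast
  define c where "c = \<bar>walsh m g u0\<bar>"
  have c: "\<bar>walsh m g u\<bar> = c" if "u \<in> A" for u
    using abs_A[OF that] abs_A[OF u0] by (simp add: c_def del: of_int_abs)
  have "2 ^ m * 2 ^ m = (\<Sum>u\<in>carrier_vec m. (walsh m g u)\<^sup>2)"
    by (simp add: walsh_parseval)
  also have "\<dots> = (\<Sum>u\<in>A. (walsh m g u)\<^sup>2)"
    using A(1) by (intro sum.mono_neutral_right) (auto simp: sup)
  also have "\<dots> = (\<Sum>u\<in>A. c\<^sup>2)"
    using c by (intro sum.cong refl) (metis power2_abs)
  also have "\<dots> = 2 ^ k * c\<^sup>2"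
    using A(2) by simp
  finally have "2 ^ k * c\<^sup>2 = 2 ^ m * 2 ^ m" by simp
  moreover have "(2::int) ^ m * 2 ^ m = 2 ^ k * (2 ^ (m - k div 2))\<^sup>2"
    using k by (auto elim!: evenE simp flip: power_add power_mult)
  ultimately have "c\<^sup>2 = (2 ^ (m - k div 2))\<^sup>2" by simp
  then have "c = 2 ^ (m - k div 2)"
    by (subst (asm) power2_eq_iff_nonneg) (auto simp: c_def)
  then show ?R using c sup by auto
next
  assume R: ?R
  have nz: "walsh m g u \<noteq> 0" if "u \<in> A" for u
    using R that by fastforce
  have "real_of_int (walsh m g u) \<in> {0, 2 powi int (m - k div 2), - (2 powi int (m - k div 2))}"
    if "u \<in> carrier_vec m" for u
  proof (cases "u \<in> A")
    case True
    then have "\<bar>walsh m g u\<bar> = 2 ^ (m - k div 2)" using R by blast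
    then have "walsh m g u = 2 ^ (m - k div 2) \<or> walsh m g u = - (2 ^ (m - k div 2))" by linarith
    then show ?thesis by (auto simp: power_int_of_nat)
  qed (use R that in auto)
  moreover have "walsh_support m g = A"
    using R A(1) nz by (auto simp: walsh_support_def)
  ultimately show ?L unfolding plateaued_def by blast
qed

text \<open>Reads off the exponent of the sign of \<open>s\<close>. The value 1 chosen at
  \<open>s = 0\<close> is harmless, since then \<open>c = 0\<close> as well.\<close>

lemma mult_bit_sign_of_abs_eq: "\<bar>s\<bar> = c \<Longrightarrow> c * bit_sign (if s > 0 then 0 else 1) = s"
  by auto

section \<open>Plateaued functions with a prescribed affine Walsh support\<close>

text \<open>An affine subspace in coordinates: \<open>a\<close> is a base point and the columns of
  \<open>M\<close> are a basis of the direction space.\<close>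

locale affine_parametrization =
  fixes m k :: nat and M :: "bit mat" and a :: "bit vec"
  assumes M [simp]: "M \<in> carrier_mat m k" and a [simp]: "a \<in> carrier_vec m"
    and kernel: "\<And>z. z \<in> carrier_vec k \<Longrightarrow> M *\<^sub>v z = 0\<^sub>v m \<Longrightarrow> z = 0\<^sub>v k"
    and even_k: "even k"
begin

definition \<phi> :: "bit vec \<Rightarrow> bit vec" where "\<phi> z = a + M *\<^sub>v z"

definition \<psi> :: "bit vec \<Rightarrow> bit vec" where "\<psi> x = M\<^sup>T *\<^sub>v x"

text \<open>Fourier inversion solved for the function whose Walsh signs on the affine subspace are
  given by \<open>e\<close>; the conditional extracts the sign of
  \<open>walsh k e (\<psi> x)\<close>.\<close>

definition lift :: "(bit vec \<Rightarrow> bit) \<Rightarrow> bit vec \<Rightarrow> bit" where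
  "lift e = (\<lambda>x\<in>carrier_vec m. a \<bullet> x + (if walsh k e (\<psi> x) > 0 then 0 else 1))"

lemma M_carrier [simp]: "M *\<^sub>v z \<in> carrier_vec m"
  using carrier_matD(1)[OF M] by (intro carrier_vecI) simp

lemma \<phi>_carrier [simp]: "\<phi> z \<in> carrier_vec m"
  by (simp add: \<phi>_def)

lemma \<psi>_carrier [simp]: "\<psi> x \<in> carrier_vec k"
  using carrier_matD(2)[OF M] by (intro carrier_vecI) (simp add: \<psi>_def)

lemma adjoint: "z \<in> carrier_vec k \<Longrightarrow> x \<in> carrier_vec m \<Longrightarrow> z \<bullet> \<psi> x = (M *\<^sub>v z) \<bullet> x"
  using transpose_vec_mult_scalar[OF M, of z x] comm_scalar_prod[of z k "\<psi> x"]
    comm_scalar_prod[of "M *\<^sub>v z" m x] \<psi>_carrier[of x] M_carrier[of z]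
  unfolding \<psi>_def by metis

lemma M_eq_0_iff: "z \<in> carrier_vec k \<Longrightarrow> M *\<^sub>v z = 0\<^sub>v m \<longleftrightarrow> z = 0\<^sub>v k"
  using kernel[of z] carrier_matD[OF M] by auto

text \<open>Addition is its own inverse, so equal images put \<open>z + z'\<close> in the kernel of
  \<open>M\<close>.\<close>

lemma inj_on_\<phi>: "inj_on \<phi> (carrier_vec k)"
proof (rule inj_onI)
  fix z z' assume z: "z \<in> carrier_vec k" "z' \<in> carrier_vec k" and eq: "\<phi> z = \<phi> z'"
  have "M *\<^sub>v z = M *\<^sub>v z'"
    using bit_vec_add_cancel[OF a M_carrier] eq unfolding \<phi>_def by metis
  then have "M *\<^sub>v (z + z') = 0\<^sub>v m"
    using z by (simp add: mult_add_distrib_mat_vec[of _ m k] bit_vec_add_self[of _ m])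
  then have "z + z' = 0\<^sub>v k"
    using z by (intro kernel) simp_all
  then show "z = z'"
    using z by (simp only: bit_vec_add_eq_0_iff)
qed

lemma k_le_m: "k \<le> m"
proof -
  have "card (\<phi> ` carrier_vec k) \<le> card (carrier_vec m :: bit vec set)"
    by (rule card_mono) auto
  then show ?thesis
    by (simp add: card_image[OF inj_on_\<phi>] card_carrier_vec_bit)
qed

text \<open>
  Surjectivity of the transpose without rank theory: by character orthogonality and injectivity
  of \<open>M\<close>, the number of solutions of \<open>\<psi> x = w\<close> times \<open>2 ^ k\<close> is \<open>2 ^ m\<close>.
\<close>

lemma \<psi>_surj:
  assumes w: "w \<in> carrier_vec k"
  obtains x where "x \<in> carrier_vec m" "\<psi> x = w"
proof -
  have "(\<Sum>x\<in>carrier_vec m. \<Sum>z\<in>carrier_vec k. bit_sign (z \<bullet> (\<psi> x + w)))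
      = (\<Sum>x\<in>carrier_vec m. \<Sum>z\<in>carrier_vec k. bit_sign ((M *\<^sub>v z) \<bullet> x) * bit_sign (z \<bullet> w))"
    using w by (intro sum.cong refl) (simp add: bit_sign_scalar_prod_add[of _ k] adjoint)
  also have "\<dots> = (\<Sum>z\<in>carrier_vec k. (\<Sum>x\<in>carrier_vec m. bit_sign ((M *\<^sub>v z) \<bullet> x)) * bit_sign (z \<bullet> w))"
    unfolding sum_distrib_right by (rule sum.swap)
  also have "\<dots> = (\<Sum>z\<in>carrier_vec k. if z = 0\<^sub>v k then 2 ^ m * bit_sign (z \<bullet> w) else 0)"
    by (intro sum.cong refl) (simp add: sum_bit_sign_scalar_prod M_eq_0_iff)
  also have "\<dots> = 2 ^ m"
    using w by simp
  finally have "(\<Sum>x\<in>carrier_vec m. \<Sum>z\<in>carrier_vec k. bit_sign (z \<bullet> (\<psi> x + w))) \<noteq> 0"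
    by simp
  \<comment> \<open>A nonzero total has a nonzero inner sum, and orthogonality in \<open>z\<close>
    then forces \<open>\<psi> x + w\<close> to vanish.\<close>
  then obtain x where x: "x \<in> carrier_vec m" "(\<Sum>z\<in>carrier_vec k. bit_sign (z \<bullet> (\<psi> x + w))) \<noteq> 0"
    by (meson sum.neutral)
  have "\<psi> x = w"
    using x(2) w by (simp add: sum_bit_sign_scalar_prod_right bit_vec_add_eq_0_iff split: if_splits)
  then show ?thesis using that x(1) by blast
qed

lemma bit_sign_\<phi>:
  "z \<in> carrier_vec k \<Longrightarrow> x \<in> carrier_vec m \<Longrightarrow>
    bit_sign (\<phi> z \<bullet> x) = bit_sign (a \<bullet> x) * bit_sign (z \<bullet> \<psi> x)"
  by (simp add: \<phi>_def bit_sign_add_scalar_prod[of _ m] adjoint)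

text \<open>A Fourier sum over the affine subspace is the Walsh transform of \<open>e\<close> pulled
  back along the transpose and twisted by the character of \<open>a\<close>.\<close>

lemma sum_\<phi>:
  assumes "x \<in> carrier_vec m"
  shows "(\<Sum>z\<in>carrier_vec k. bit_sign (e z) * bit_sign (\<phi> z \<bullet> x)) = bit_sign (a \<bullet> x) * walsh k e (\<psi> x)"
  unfolding walsh_altdef sum_distrib_left
  using assms by (intro sum.cong refl) (simp add: bit_sign_\<phi> comm_scalar_prod[of "\<psi> x" k])

section \<open>The bijection between bent functions and plateaued functions on a fixed
  support\<close>

lemma lift_boolean_functions: "lift e \<in> boolean_functions m"
  by (simp add: lift_def boolean_functions_def)

text \<open>Bentness fixes the absolute value of the Walsh transform of \<open>e\<close>, so the
  sign kept by \<open>lift\<close> loses no information.\<close>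

lemma bit_sign_lift:
  assumes e: "bent k e" and x: "x \<in> carrier_vec m"
  shows "2 ^ (k div 2) * bit_sign (lift e x) = bit_sign (a \<bullet> x) * walsh k e (\<psi> x)"
proof -
  have "\<bar>walsh k e (\<psi> x)\<bar> = 2 ^ (k div 2)"
    using e bent_iff_abs_walsh[OF even_k] by simp
  from mult_bit_sign_of_abs_eq[OF this] x show ?thesis
    unfolding lift_def restrict_apply'[OF x] bit_sign_add by (metis mult.left_commute)
qed

lemma two_power: "(2::int) ^ m = 2 ^ (k div 2) * 2 ^ (m - k div 2)"
  using k_le_m by (simp flip: power_add)

text \<open>Multiplying by \<open>2 ^ (k div 2)\<close> allows each sign of \<open>lift e\<close> to
  be replaced by a Fourier sum over \<open>z\<close>; orthogonality in \<open>x\<close> keeps only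
  \<open>\<phi> z = u\<close>, and the factor is cancelled at the end.\<close>

lemma walsh_lift:
  assumes e: "bent k e" and u: "u \<in> carrier_vec m"
  shows "walsh m (lift e) u = (\<Sum>z\<in>carrier_vec k. if \<phi> z = u then 2 ^ (m - k div 2) * bit_sign (e z) else 0)"
proof -
  have "2 ^ (k div 2) * walsh m (lift e) u
      = (\<Sum>x\<in>carrier_vec m. bit_sign (u \<bullet> x) * (2 ^ (k div 2) * bit_sign (lift e x)))"
    unfolding walsh_altdef sum_distrib_left by (simp add: mult_ac)
  also have "\<dots> = (\<Sum>x\<in>carrier_vec m. \<Sum>z\<in>carrier_vec k. bit_sign (u \<bullet> x) * (bit_sign (e z) * bit_sign (\<phi> z \<bullet> x)))"
    by (intro sum.cong refl) (simp add: bit_sign_lift[OF e] sum_\<phi>[symmetric] sum_distrib_left)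
  also have "\<dots> = (\<Sum>z\<in>carrier_vec k. \<Sum>x\<in>carrier_vec m. bit_sign (u \<bullet> x) * (bit_sign (e z) * bit_sign (\<phi> z \<bullet> x)))"
    by (rule sum.swap)
  also have "\<dots> = (\<Sum>z\<in>carrier_vec k. bit_sign (e z) * (\<Sum>x\<in>carrier_vec m. bit_sign ((\<phi> z + u) \<bullet> x)))"
    unfolding sum_distrib_left
    using u by (intro sum.cong refl) (simp add: bit_sign_add_scalar_prod[of _ m] mult_ac)
  also have "\<dots> = (\<Sum>z\<in>carrier_vec k. 2 ^ (k div 2) *
      (if \<phi> z = u then 2 ^ (m - k div 2) * bit_sign (e z) else 0))"
    using u by (intro sum.cong refl)
      (simp add: sum_bit_sign_scalar_prod bit_vec_add_eq_0_iff two_power)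
  finally show ?thesis
    by (simp flip: sum_distrib_left)
qed

lemma walsh_lift_\<phi>:
  assumes e: "bent k e" and z: "z \<in> carrier_vec k"
  shows "walsh m (lift e) (\<phi> z) = 2 ^ (m - k div 2) * bit_sign (e z)"
proof -
  have "walsh m (lift e) (\<phi> z)
      = (\<Sum>y\<in>carrier_vec k. if y = z then 2 ^ (m - k div 2) * bit_sign (e y) else 0)"
    unfolding walsh_lift[OF e \<phi>_carrier]
    using z inj_onD[OF inj_on_\<phi>] by (intro sum.cong refl) auto
  then show ?thesis using z by simp
qed

lemma walsh_lift_outside:
  assumes e: "bent k e" and u: "u \<in> carrier_vec m - \<phi> ` carrier_vec k"
  shows "walsh m (lift e) u = 0"
  using u by (subst walsh_lift[OF e]) (auto intro!: sum.neutral)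

lemma plateaued_iff:
  "plateaued m g \<and> walsh_support m g = \<phi> ` carrier_vec k \<longleftrightarrow>
    (\<forall>z\<in>carrier_vec k. \<bar>walsh m g (\<phi> z)\<bar> = 2 ^ (m - k div 2)) \<and>
    (\<forall>u\<in>carrier_vec m - \<phi> ` carrier_vec k. walsh m g u = 0)"
  by (subst plateaued_walsh_support_iff[OF _ _ even_k k_le_m])
    (auto simp: card_image[OF inj_on_\<phi>] card_carrier_vec_bit)

text \<open>The preimage \<open>e\<close> records the signs of the Walsh transform of
  \<open>g\<close> on the support. Inversion yields the identity \<open>key\<close>, which shows
  both that \<open>e\<close> is bent and that it lifts to \<open>g\<close>.\<close>

lemma lift_surj:
  assumes g: "g \<in> boolean_functions m" "plateaued m g" "walsh_support m g = \<phi> ` carrier_vec k"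
  obtains e where "e \<in> boolean_functions k" "bent k e" "lift e = g"
proof -
  define e where "e = (\<lambda>z\<in>carrier_vec k. if walsh m g (\<phi> z) > 0 then 0 else (1::bit))"
  let ?c = "2 ^ (m - k div 2) :: int"
  have abs: "\<And>z. z \<in> carrier_vec k \<Longrightarrow> \<bar>walsh m g (\<phi> z)\<bar> = ?c"
    and zero: "\<And>u. u \<in> carrier_vec m - \<phi> ` carrier_vec k \<Longrightarrow> walsh m g u = 0"
    using plateaued_iff[of g] g(2,3) by auto
  have e: "walsh m g (\<phi> z) = ?c * bit_sign (e z)" if "z \<in> carrier_vec k" for z
    using mult_bit_sign_of_abs_eq[OF abs[OF that]] that by (simp add: e_def)
  have key: "2 ^ (k div 2) * bit_sign (g x) = bit_sign (a \<bullet> x) * walsh k e (\<psi> x)"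
    if x: "x \<in> carrier_vec m" for x
  proof -
    have "2 ^ m * bit_sign (g x) = (\<Sum>u\<in>carrier_vec m. walsh m g u * bit_sign (u \<bullet> x))"
      using walsh_inversion[OF x, of g] by simp
    also have "\<dots> = (\<Sum>u\<in>\<phi> ` carrier_vec k. walsh m g u * bit_sign (u \<bullet> x))"
      by (rule sum.mono_neutral_right) (auto simp: zero)
    also have "\<dots> = (\<Sum>z\<in>carrier_vec k. walsh m g (\<phi> z) * bit_sign (\<phi> z \<bullet> x))"
      by (simp add: sum.reindex[OF inj_on_\<phi>])
    also have "\<dots> = ?c * (bit_sign (a \<bullet> x) * walsh k e (\<psi> x))"
      unfolding sum_\<phi>[OF x, symmetric] sum_distrib_left
      by (intro sum.cong refl) (simp add: e)
    finally show ?thesis by (simp add: two_power)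
  qed
  have "bent k e"
    unfolding bent_iff_abs_walsh[OF even_k]
  proof
    fix w :: "bit vec" assume "w \<in> carrier_vec k"
    \<comment> \<open>Surjectivity of the transpose makes \<open>key\<close> control the Walsh
      transform of \<open>e\<close> at every point, not only at those in an image.\<close>
    then obtain x where x: "x \<in> carrier_vec m" "\<psi> x = w" by (rule \<psi>_surj)
    from arg_cong[OF key[OF x(1)], of abs] show "\<bar>walsh k e w\<bar> = 2 ^ (k div 2)"
      by (simp add: abs_mult x(2))
  qed
  moreover have "lift e = g"
  proof (rule extensionalityI)
    show "lift e \<in> extensional (carrier_vec m)" by (simp add: lift_def)
    show "g \<in> extensional (carrier_vec m)" using g(1) by (simp add: boolean_functions_def PiE_def)
    fix x :: "bit vec" assume x: "x \<in> carrier_vec m"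
    have "2 ^ (k div 2) * bit_sign (lift e x) = 2 ^ (k div 2) * bit_sign (g x)"
      using bit_sign_lift[OF \<open>bent k e\<close> x] key[OF x] by simp
    then show "lift e x = g x" by simp
  qed
  moreover have "e \<in> boolean_functions k" by (simp add: e_def boolean_functions_def)
  ultimately show ?thesis using that by blast
qed

text \<open>Injectivity holds because the Walsh values of \<open>lift e\<close> on the support
  return the signs of \<open>e\<close>.\<close>

lemma bij_betw_lift:
  "bij_betw lift {e \<in> boolean_functions k. bent k e}
    {g \<in> boolean_functions m. plateaued m g \<and> walsh_support m g = \<phi> ` carrier_vec k}"
proof (rule bij_betwI')
  fix e e' assume e: "e \<in> {e \<in> boolean_functions k. bent k e}" "e' \<in> {e \<in> boolean_functions k. bent k e}"
  show "lift e = lift e' \<longleftrightarrow> e = e'"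
  proof
    assume eq: "lift e = lift e'"
    show "e = e'"
    proof (rule extensionalityI)
      show "e \<in> extensional (carrier_vec k)" "e' \<in> extensional (carrier_vec k)"
        using e by (auto simp: boolean_functions_def PiE_def)
      fix z :: "bit vec" assume "z \<in> carrier_vec k"
      then show "e z = e' z"
        using walsh_lift_\<phi>[of e z] walsh_lift_\<phi>[of e' z] e eq by simp
    qed
  qed simp
next
  fix e assume "e \<in> {e \<in> boolean_functions k. bent k e}"
  then have e: "bent k e" by simp
  show "lift e \<in> {g \<in> boolean_functions m. plateaued m g \<and> walsh_support m g = \<phi> ` carrier_vec k}"
    unfolding plateaued_iff
    by (simp add: lift_boolean_functions walsh_lift_\<phi>[OF e] walsh_lift_outside[OF e] abs_mult)
next
  fix g assume "g \<in> {g \<in> boolean_functions m. plateaued m g \<and> walsh_support m g = \<phi> ` carrier_vec k}"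
  then have "g \<in> boolean_functions m" "plateaued m g" "walsh_support m g = \<phi> ` carrier_vec k"
    by simp_all
  then obtain e where "e \<in> boolean_functions k" "bent k e" "lift e = g"
    by (rule lift_surj)
  then show "\<exists>e\<in>{e \<in> boolean_functions k. bent k e}. g = lift e"
    by (intro bexI[of _ e]) simp_all
qed

end

section \<open>Consequences for arbitrary affine subspaces\<close>

lemma affine_subspace_parametrization:
  assumes "affine_subspace m k A" "even k"
  obtains M a where "affine_parametrization m k M a" "A = affine_parametrization.\<phi> M a ` carrier_vec k"
proof -
  from assms(1) obtain a S where a: "a \<in> carrier_vec m" and S: "linear_subspace m k S"
    and A: "A = (\<lambda>s. a + s) ` S"
    unfolding affine_subspace_def by blast
  from S obtain M where M: "M \<in> carrier_mat m k" "S = (\<lambda>z. M *\<^sub>v z) ` carrier_vec k"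
    "\<forall>z\<in>carrier_vec k. M *\<^sub>v z = 0\<^sub>v m \<longrightarrow> z = 0\<^sub>v k"
    by (rule linear_subspace_matrix_image)
  interpret P: affine_parametrization m k M a
    by unfold_locales (use a M assms(2) in auto)
  have "A = P.\<phi> ` carrier_vec k"
    by (simp add: A M(2) image_image P.\<phi>_def)
  then show ?thesis using that P.affine_parametrization_axioms by blast
qed

text \<open>The count depends only on the dimension of \<open>A\<close>, so every block of a
  partition contributes the same factor.\<close>

lemma card_plateaued_walsh_support:
  assumes "affine_subspace m k A" "even k"
  shows "card {g \<in> boolean_functions m. plateaued m g \<and> walsh_support m g = A} = num_bent k"
proof -
  obtain M a where P: "affine_parametrization m k M a" and A: "A = affine_parametrization.\<phi> M a ` carrier_vec k"
    using affine_subspace_parametrization[OF assms] .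
  interpret affine_parametrization m k M a by (rule P)
  show ?thesis
    using bij_betw_same_card[OF bij_betw_lift] by (simp add: A num_bent_def)
qed

lemma abs_walsh_plateaued:
  assumes "affine_subspace m k A" "even k" "plateaued m g" "walsh_support m g = A" "u \<in> A"
  shows "\<bar>walsh m g u\<bar> = 2 ^ (m - k div 2)"
proof -
  obtain M a where P: "affine_parametrization m k M a" and A: "A = affine_parametrization.\<phi> M a ` carrier_vec k"
    using affine_subspace_parametrization[OF assms(1,2)] .
  interpret affine_parametrization m k M a by (rule P)
  show ?thesis
    using plateaued_iff[of g] assms A by auto
qed


section \<open>Construction (K)\<close>

lemma monomial_eq:
  assumes "x \<in> carrier_vec n" "a \<in> carrier_vec n"
  shows "monomial x a = (if x = a then 1 else 0)"
proof (cases "x = a")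
  case True
  have "bit_pow b b = 1" for b by (cases b) (simp_all add: bit_pow_def)
  then show ?thesis using True by (simp add: monomial_def)
next
  case False
  then obtain i where i: "i < n" "x $ i \<noteq> a $ i"
    using assms by (metis carrier_vecD eq_vecI)
  have "b \<noteq> c \<Longrightarrow> bit_pow b c = 0" for b c
    by (cases b; cases c) (simp_all add: bit_pow_def)
  then have "\<exists>j\<in>{..<n}. bit_pow (x $ j) (a $ j) = 0"
    using i by blast
  then show ?thesis
    using False assms(1) by (simp add: monomial_def prod_zero)
qed

text \<open>Each monomial is the indicator of a single word, so the sum defining construction (K)
  selects the component indexed by \<open>x\<close>.\<close>

lemma sum_monomial:
  assumes "x \<in> carrier_vec n"
  shows "(\<Sum>a\<in>carrier_vec n. h a * monomial x a) = h x"
proof -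
  have "(\<Sum>a\<in>carrier_vec n. h a * monomial x a) = (\<Sum>a\<in>carrier_vec n. if a = x then h a else 0)"
    using assms by (intro sum.cong refl) (simp add: monomial_eq[of _ n])
  then show ?thesis using assms by simp
qed

lemma bij_betw_append_vec:
  "bij_betw (\<lambda>(x, y). x @\<^sub>v y) (carrier_vec n1 \<times> carrier_vec n2) (carrier_vec (n1 + n2))"
proof (rule bij_betwI')
  fix p q :: "'a vec \<times> 'a vec"
  assume "p \<in> carrier_vec n1 \<times> carrier_vec n2" "q \<in> carrier_vec n1 \<times> carrier_vec n2"
  then show "(case p of (x, y) \<Rightarrow> x @\<^sub>v y) = (case q of (x, y) \<Rightarrow> x @\<^sub>v y) \<longleftrightarrow> p = q"
    by (cases p; cases q) (simp add: append_vec_eq[of _ n1])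
next
  fix p :: "'a vec \<times> 'a vec" assume "p \<in> carrier_vec n1 \<times> carrier_vec n2"
  then show "(case p of (x, y) \<Rightarrow> x @\<^sub>v y) \<in> carrier_vec (n1 + n2)" by auto
next
  fix w :: "'a vec" assume "w \<in> carrier_vec (n1 + n2)"
  then have "w = (case (vec_first w n1, vec_last w n2) of (x, y) \<Rightarrow> x @\<^sub>v y)" by simp
  moreover have "(vec_first w n1, vec_last w n2) \<in> carrier_vec n1 \<times> carrier_vec n2" by simp
  ultimately show "\<exists>p\<in>carrier_vec n1 \<times> carrier_vec n2. w = (case p of (x, y) \<Rightarrow> x @\<^sub>v y)" by blast
qed

text \<open>The scalar product splits over the two blocks of coordinates; summing over
  \<open>y\<close> first produces the Walsh transforms of the components.\<close>

lemma walsh_append: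
  assumes "u \<in> carrier_vec n1" "v \<in> carrier_vec n2"
    and f: "\<And>x y. x \<in> carrier_vec n1 \<Longrightarrow> y \<in> carrier_vec n2 \<Longrightarrow> f (x @\<^sub>v y) = g x y"
  shows "walsh (n1 + n2) f (u @\<^sub>v v) = (\<Sum>x\<in>carrier_vec n1. bit_sign (u \<bullet> x) * walsh n2 (g x) v)"
proof -
  have "walsh (n1 + n2) f (u @\<^sub>v v)
      = (\<Sum>(x, y)\<in>carrier_vec n1 \<times> carrier_vec n2. bit_sign ((u @\<^sub>v v) \<bullet> (x @\<^sub>v y)) * bit_sign (f (x @\<^sub>v y)))"
    unfolding walsh_altdef
    by (subst sum.reindex_bij_betw[OF bij_betw_append_vec, symmetric]) (simp add: case_prod_unfold)
  also have "\<dots> = (\<Sum>x\<in>carrier_vec n1. \<Sum>y\<in>carrier_vec n2. bit_sign ((u @\<^sub>v v) \<bullet> (x @\<^sub>v y)) * bit_sign (f (x @\<^sub>v y)))"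
    by (rule sum.cartesian_product[symmetric])
  also have "\<dots> = (\<Sum>x\<in>carrier_vec n1. \<Sum>y\<in>carrier_vec n2. bit_sign (u \<bullet> x) * (bit_sign (v \<bullet> y) * bit_sign (g x y)))"
    by (intro sum.cong refl)
      (simp only: scalar_prod_append[OF assms(1,2)] f bit_sign_add mult.assoc)
  finally show ?thesis
    unfolding walsh_altdef sum_distrib_left .
qed

section \<open>Ordered partitions and their index sets\<close>

lemma affine_subspace_subset:
  assumes "affine_subspace m k A"
  shows "A \<subseteq> carrier_vec m"
proof -
  obtain a S where a: "a \<in> carrier_vec m" and S: "linear_subspace m k S" and A: "A = (\<lambda>s. a + s) ` S"
    using assms unfolding affine_subspace_def by blast
  obtain M where M: "M \<in> carrier_mat m k" "S = (\<lambda>z. M *\<^sub>v z) ` carrier_vec k"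
    using S by (rule linear_subspace_matrix_image)
  show ?thesis
    unfolding A M(2) using a mult_mat_vec_carrier[OF M(1)] by (auto simp: image_subset_iff)
qed

lemma finite_ordered_affine_partitions:
  assumes "finite I"
  shows "finite (ordered_affine_partitions I m k)"
proof (rule finite_subset)
  show "ordered_affine_partitions I m k \<subseteq> I \<rightarrow>\<^sub>E Pow (carrier_vec m)"
    unfolding ordered_affine_partitions_def using affine_subspace_subset
    by (intro subsetI) (simp add: PiE_iff subset_iff, blast)
  show "finite (I \<rightarrow>\<^sub>E Pow (carrier_vec m :: bit vec set))"
    using assms by (intro finite_PiE) simp_all
qed

lemma ordered_affine_partitions_reindex:
  assumes h: "bij_betw h I J" and C: "C \<in> ordered_affine_partitions J m k"
  shows "(\<lambda>i\<in>I. C (h i)) \<in> ordered_affine_partitions I m k"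
proof -
  have C': "C \<in> J \<rightarrow>\<^sub>E {A. affine_subspace m k A}" "disjoint_family_on C J" "(\<Union>j\<in>J. C j) = carrier_vec m"
    using C by (simp_all add: ordered_affine_partitions_def)
  have hJ: "h i \<in> J" if "i \<in> I" for i using h that by (rule bij_betw_apply)
  have "(\<lambda>i\<in>I. C (h i)) \<in> I \<rightarrow>\<^sub>E {A. affine_subspace m k A}"
    using C'(1) hJ by (simp add: PiE_iff)
  moreover have "disjoint_family_on (\<lambda>i\<in>I. C (h i)) I"
  proof (unfold disjoint_family_on_def, intro ballI impI)
    fix i j assume ij: "i \<in> I" "j \<in> I" "i \<noteq> j"
    then have "h i \<noteq> h j" using h by (metis bij_betw_inv_into_left)
    then show "(\<lambda>i\<in>I. C (h i)) i \<inter> (\<lambda>i\<in>I. C (h i)) j = {}"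
      using C'(2) ij hJ by (simp add: disjoint_family_on_def)
  qed
  moreover have "(\<Union>i\<in>I. (\<lambda>i\<in>I. C (h i)) i) = (\<Union>j\<in>h ` I. C j)"
    by simp
  then have "(\<Union>i\<in>I. (\<lambda>i\<in>I. C (h i)) i) = carrier_vec m"
    by (simp only: bij_betw_imp_surj_on[OF h] C'(3))
  ultimately show ?thesis
    unfolding ordered_affine_partitions_def by blast
qed

text \<open>Only the number of positions matters. This links partitions indexed by words, as in
  construction (K), with those indexed by an initial segment of the naturals.\<close>

lemma card_ordered_affine_partitions_reindex:
  assumes h: "bij_betw h I J"
  shows "card (ordered_affine_partitions I m k) = card (ordered_affine_partitions J m k)"
proof -
  let ?h' = "inv_into I h"
  have h': "bij_betw ?h' J I" by (rule bij_betw_inv_into[OF h])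
  have ext: "C \<in> extensional I" if "C \<in> ordered_affine_partitions I m k" for C and I :: "'x set"
    using that by (simp add: ordered_affine_partitions_def PiE_iff)
  have "bij_betw (\<lambda>C. \<lambda>j\<in>J. C (?h' j)) (ordered_affine_partitions I m k) (ordered_affine_partitions J m k)"
  proof (rule bij_betw_byWitness[where f' = "\<lambda>C. \<lambda>i\<in>I. C (h i)"])
    show "\<forall>C\<in>ordered_affine_partitions I m k. (\<lambda>i\<in>I. (\<lambda>j\<in>J. C (?h' j)) (h i)) = C"
    proof
      fix C assume "C \<in> ordered_affine_partitions I m k"
      from ext[OF this] show "(\<lambda>i\<in>I. (\<lambda>j\<in>J. C (?h' j)) (h i)) = C"
        by (rule extensionalityI[OF restrict_extensional])
          (simp add: bij_betw_apply[OF h] bij_betw_inv_into_left[OF h])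
    qed
    show "\<forall>C\<in>ordered_affine_partitions J m k. (\<lambda>j\<in>J. (\<lambda>i\<in>I. C (h i)) (?h' j)) = C"
    proof
      fix C :: "'b \<Rightarrow> bit vec set" assume C: "C \<in> ordered_affine_partitions J m k"
      then have "C \<in> extensional J" by (simp add: ordered_affine_partitions_def PiE_iff)
      then show "(\<lambda>j\<in>J. (\<lambda>i\<in>I. C (h i)) (?h' j)) = C"
        by (rule extensionalityI[OF restrict_extensional])
          (simp add: bij_betw_apply[OF h'] bij_betw_inv_into_right[OF h])
    qed
  qed (use ordered_affine_partitions_reindex[OF h] ordered_affine_partitions_reindex[OF h'] in blast)+
  then show ?thesis by (rule bij_betw_same_card)
qed

section \<open>Functions assembled from their components\<close>

definition assemble :: "nat \<Rightarrow> nat \<Rightarrow> (bit vec \<Rightarrow> bit vec \<Rightarrow> bit) \<Rightarrow> bit vec \<Rightarrow> bit" where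
  "assemble n1 n2 g = (\<lambda>w\<in>carrier_vec (n1 + n2). g (vec_first w n1) (vec_last w n2))"

lemma assemble_append:
  assumes "x \<in> carrier_vec n1" "y \<in> carrier_vec n2"
  shows "assemble n1 n2 g (x @\<^sub>v y) = g x y"
proof -
  have "x @\<^sub>v y \<in> carrier_vec (n1 + n2)" using assms by simp
  moreover have "vec_first (x @\<^sub>v y) n1 = x" "vec_last (x @\<^sub>v y) n2 = y"
    using assms by (auto simp: vec_first_def vec_last_def)
  ultimately show ?thesis by (simp add: assemble_def)
qed

lemma boolean_function_eqI:
  assumes "f \<in> boolean_functions (n1 + n2)" "f' \<in> boolean_functions (n1 + n2)"
    and "\<And>x y. x \<in> carrier_vec n1 \<Longrightarrow> y \<in> carrier_vec n2 \<Longrightarrow> f (x @\<^sub>v y) = f' (x @\<^sub>v y)"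
  shows "f = f'"
proof (rule extensionalityI)
  show "f \<in> extensional (carrier_vec (n1 + n2))" "f' \<in> extensional (carrier_vec (n1 + n2))"
    using assms(1,2) by (simp_all add: boolean_functions_def PiE_iff)
  fix w :: "bit vec" assume "w \<in> carrier_vec (n1 + n2)"
  then have "w = vec_first w n1 @\<^sub>v vec_last w n2" by simp
  then show "f w = f' w"
    using assms(3)[of "vec_first w n1" "vec_last w n2"] by simp
qed

lemma assemble_boolean_functions: "assemble n1 n2 g \<in> boolean_functions (n1 + n2)"
  by (simp add: assemble_def boolean_functions_def)

text \<open>Fixing the first argument recovers the component, so counting functions reduces to
  counting families of components.\<close>

lemma inj_on_assemble: "inj_on (assemble n1 n2) (carrier_vec n1 \<rightarrow>\<^sub>E boolean_functions n2)"
proof (rule inj_onI)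
  fix g g' assume g: "g \<in> carrier_vec n1 \<rightarrow>\<^sub>E boolean_functions n2" "g' \<in> carrier_vec n1 \<rightarrow>\<^sub>E boolean_functions n2"
    and eq: "assemble n1 n2 g = assemble n1 n2 g'"
  show "g = g'"
  proof (rule PiE_ext[OF g])
    fix x :: "bit vec" assume x: "x \<in> carrier_vec n1"
    show "g x = g' x"
    proof (rule PiE_ext)
      show "g x \<in> carrier_vec n2 \<rightarrow>\<^sub>E UNIV" "g' x \<in> carrier_vec n2 \<rightarrow>\<^sub>E UNIV"
        using PiE_mem[OF g(1) x] PiE_mem[OF g(2) x] by (simp_all add: boolean_functions_def)
      fix y :: "bit vec" assume y: "y \<in> carrier_vec n2"
      show "g x y = g' x y"
        using assemble_append[OF x y, of g] assemble_append[OF x y, of g'] eq by simp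
    qed
  qed
qed

definition plateaued_on :: "nat \<Rightarrow> bit vec set \<Rightarrow> (bit vec \<Rightarrow> bit) set" where
  "plateaued_on m A = {g \<in> boolean_functions m. plateaued m g \<and> walsh_support m g = A}"

lemma finite_boolean_functions: "finite (boolean_functions m)"
proof -
  have "finite (UNIV :: bit set)" by (subst UNIV_bit) simp
  then show ?thesis unfolding boolean_functions_def by (intro finite_PiE) simp_all
qed

lemma finite_plateaued_on: "finite (plateaued_on m A)"
  by (rule finite_subset[OF _ finite_boolean_functions[of m]]) (auto simp: plateaued_on_def)

text \<open>Once the monomial sum has collapsed, the construction is the image of a union of product
  sets, a form suited to counting.\<close>

lemma construction_K_eq:
  "construction_K n1 n2 = assemble n1 n2 `
    (\<Union>C\<in>ordered_affine_partitions (carrier_vec n1) n2 (n2 - n1). \<Pi>\<^sub>E a\<in>carrier_vec n1. plateaued_on n2 (C a))"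
  (is "?L = ?R")
proof (intro equalityI subsetI)
  fix f assume "f \<in> ?L"
  then obtain C g where f: "f \<in> boolean_functions (n1 + n2)"
    and C: "C \<in> ordered_affine_partitions (carrier_vec n1) n2 (n2 - n1)"
    and g: "\<forall>a\<in>carrier_vec n1. g a \<in> boolean_functions n2 \<and> plateaued n2 (g a) \<and> walsh_support n2 (g a) = C a"
    and fg: "\<forall>x\<in>carrier_vec n1. \<forall>y\<in>carrier_vec n2. f (x @\<^sub>v y) = (\<Sum>a\<in>carrier_vec n1. g a y * monomial x a)"
    unfolding construction_K_def by blast
  \<comment> \<open>Restricting the family to its index set changes no value of \<open>f\<close> and
    places it in the extensional product.\<close>
  have "f = assemble n1 n2 (restrict g (carrier_vec n1))"
    by (rule boolean_function_eqI[OF f assemble_boolean_functions])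
      (simp only: fg[rule_format] sum_monomial assemble_append restrict_apply')
  moreover have "restrict g (carrier_vec n1) \<in> (\<Pi>\<^sub>E a\<in>carrier_vec n1. plateaued_on n2 (C a))"
    using g by (simp add: plateaued_on_def PiE_iff)
  ultimately show "f \<in> ?R" using C by blast
next
  fix f assume "f \<in> ?R"
  then obtain C g where C: "C \<in> ordered_affine_partitions (carrier_vec n1) n2 (n2 - n1)"
    and g: "g \<in> (\<Pi>\<^sub>E a\<in>carrier_vec n1. plateaued_on n2 (C a))" and f: "f = assemble n1 n2 g"
    by blast
  have "\<forall>a\<in>carrier_vec n1. g a \<in> boolean_functions n2 \<and> plateaued n2 (g a) \<and> walsh_support n2 (g a) = C a"
    using g by (simp add: plateaued_on_def PiE_iff)
  moreover have "\<forall>x\<in>carrier_vec n1. \<forall>y\<in>carrier_vec n2. f (x @\<^sub>v y) = (\<Sum>a\<in>carrier_vec n1. g a y * monomial x a)"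
    by (intro ballI) (simp only: f sum_monomial assemble_append)
  moreover have "f \<in> boolean_functions (n1 + n2)"
    by (simp add: f assemble_boolean_functions)
  ultimately show "f \<in> ?L"
    unfolding construction_K_def using C by blast
qed

text \<open>The vector \<open>v\<close> lies in exactly one block, so a single component contributes
  to the Walsh coefficient, and it has the amplitude of a bent function.\<close>

lemma bent_assemble:
  assumes n: "n1 \<le> n2" "even (n2 - n1)"
    and C: "C \<in> ordered_affine_partitions (carrier_vec n1) n2 (n2 - n1)"
    and g: "g \<in> (\<Pi>\<^sub>E a\<in>carrier_vec n1. plateaued_on n2 (C a))"
  shows "bent (n1 + n2) (assemble n1 n2 g)"
proof -
  have C': "\<And>a. a \<in> carrier_vec n1 \<Longrightarrow> affine_subspace n2 (n2 - n1) (C a)"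
    "disjoint_family_on C (carrier_vec n1)" "(\<Union>a\<in>carrier_vec n1. C a) = carrier_vec n2"
    using C by (auto simp: ordered_affine_partitions_def)
  have g': "plateaued n2 (g a)" "walsh_support n2 (g a) = C a" if "a \<in> carrier_vec n1" for a
    using PiE_mem[OF g that] by (simp_all add: plateaued_on_def)
  have "n1 + n2 = 2 * n1 + (n2 - n1)" using n(1) by simp
  then have "even (n1 + n2)" using n(2) by (metis even_add even_mult_iff even_numeral)
  \<comment> \<open>Evenness makes the halving exact, so the amplitude exponent of a component
    equals the exponent required of a bent function in \<open>n1 + n2\<close> variables.\<close>
  from n(2) obtain r where "n2 - n1 = 2 * r" by (rule evenE)
  then have "n2 - (n2 - n1) div 2 = (n1 + n2) div 2" using n(1) by simp
  have "\<bar>walsh (n1 + n2) (assemble n1 n2 g) w\<bar> = 2 ^ ((n1 + n2) div 2)"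
    if "w \<in> carrier_vec (n1 + n2)" for w
  proof -
    define u v where "u = vec_first w n1" and "v = vec_last w n2"
    have w: "w = u @\<^sub>v v" and u: "u \<in> carrier_vec n1" and v: "v \<in> carrier_vec n2"
      using that by (simp_all add: u_def v_def)
    from v obtain b where b: "b \<in> carrier_vec n1" "v \<in> C b"
      using C'(3) by blast
    have zero: "walsh n2 (g a) v = 0" if a: "a \<in> carrier_vec n1" "a \<noteq> b" for a
    proof -
      have "v \<notin> C a" using C'(2) a b by (auto simp: disjoint_family_on_def)
      then show ?thesis using g'(2)[OF a(1)] v by (auto simp: walsh_support_def)
    qed
    have "walsh (n1 + n2) (assemble n1 n2 g) w = (\<Sum>a\<in>carrier_vec n1. bit_sign (u \<bullet> a) * walsh n2 (g a) v)"
      unfolding w by (rule walsh_append[OF u v]) (rule assemble_append)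
    also have "\<dots> = (\<Sum>a\<in>carrier_vec n1. if a = b then bit_sign (u \<bullet> a) * walsh n2 (g a) v else 0)"
      by (intro sum.cong refl) (simp add: zero)
    also have "\<dots> = bit_sign (u \<bullet> b) * walsh n2 (g b) v"
      using b(1) by simp
    finally show ?thesis
      using abs_walsh_plateaued[OF C'(1)[OF b(1)] n(2) g'[OF b(1)] b(2)]
      by (simp add: abs_mult \<open>n2 - (n2 - n1) div 2 = (n1 + n2) div 2\<close>)
  qed
  then show ?thesis
    using bent_iff_abs_walsh[OF \<open>even (n1 + n2)\<close>] by blast
qed

section \<open>Bentness and the count over all partitions\<close>

theorem theorem4:
  fixes n n1 n2 :: nat
  assumes "n = n1 + n2" and "n1 \<le> n2" and "even n" and "even (n2 - n1)"
  shows "(\<forall>f\<in>construction_K n1 n2. bent n f) \<and>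
    card (construction_K n1 n2) =
      num_bent (n2 - n1) ^ (2 ^ n1) * num_ordered_affine_partitions n2 (n2 - n1)"
proof
  show "\<forall>f\<in>construction_K n1 n2. bent n f"
    unfolding construction_K_eq assms(1) using bent_assemble[OF assms(2,4)] by blast
next
  let ?P = "ordered_affine_partitions (carrier_vec n1 :: bit vec set) n2 (n2 - n1)"
  let ?G = "\<lambda>C. \<Pi>\<^sub>E a\<in>(carrier_vec n1 :: bit vec set). plateaued_on n2 (C a)"
  have P_ext: "C \<in> extensional (carrier_vec n1)" if "C \<in> ?P" for C
    using that by (simp add: ordered_affine_partitions_def PiE_iff)
  \<comment> \<open>The Walsh supports of the components recover the blocks, so different partitions
    give disjoint sets of families and the cardinalities add.\<close>
  have disj: "C = C'" if "C \<in> ?P" "C' \<in> ?P" "g \<in> ?G C" "g \<in> ?G C'" for C C' g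
    using P_ext[OF that(1)] P_ext[OF that(2)]
  proof (rule extensionalityI)
    fix a :: "bit vec" assume a: "a \<in> carrier_vec n1"
    show "C a = C' a"
      using PiE_mem[OF that(3) a] PiE_mem[OF that(4) a] by (simp add: plateaued_on_def)
  qed
  have "(\<Union>C\<in>?P. ?G C) \<subseteq> carrier_vec n1 \<rightarrow>\<^sub>E boolean_functions n2"
    by (intro UN_least PiE_mono) (simp add: plateaued_on_def)
  then have "inj_on (assemble n1 n2) (\<Union>C\<in>?P. ?G C)"
    by (rule inj_on_subset[OF inj_on_assemble])
  then have "card (construction_K n1 n2) = card (\<Union>C\<in>?P. ?G C)"
    unfolding construction_K_eq by (rule card_image)
  also have "\<dots> = (\<Sum>C\<in>?P. card (?G C))"
  proof (rule card_UN_disjoint)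
    show "finite ?P" by (simp add: finite_ordered_affine_partitions)
    show "\<forall>C\<in>?P. finite (?G C)" by (simp add: finite_PiE finite_plateaued_on)
    show "\<forall>C\<in>?P. \<forall>C'\<in>?P. C \<noteq> C' \<longrightarrow> ?G C \<inter> ?G C' = {}"
      using disj by blast
  qed
  also have "\<dots> = (\<Sum>C\<in>?P. num_bent (n2 - n1) ^ (2 ^ n1))"
  proof (rule sum.cong[OF refl])
    fix C assume C: "C \<in> ?P"
    have "card (plateaued_on n2 (C a)) = num_bent (n2 - n1)" if "a \<in> carrier_vec n1" for a
    proof -
      have "affine_subspace n2 (n2 - n1) (C a)"
        using C that by (auto simp: ordered_affine_partitions_def)
      then show ?thesis
        unfolding plateaued_on_def using assms(4) by (rule card_plateaued_walsh_support)
    qed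
    then show "card (?G C) = num_bent (n2 - n1) ^ (2 ^ n1)"
      by (simp add: card_PiE card_carrier_vec_bit)
  qed
  also have "\<dots> = num_bent (n2 - n1) ^ (2 ^ n1) * card ?P"
    by simp
  also have "card ?P = num_ordered_affine_partitions n2 (n2 - n1)"
  proof -
    \<comment> \<open>By \<open>n1 \<le> n2\<close> the exponent \<open>n2 - (n2 - n1)\<close> is
      \<open>n1\<close>, so both index sets have the same size.\<close>
    have "card (carrier_vec n1 :: bit vec set) = card {..<(2::nat) ^ (n2 - (n2 - n1))}"
      using assms(2) by (simp add: card_carrier_vec_bit)
    then obtain h where "bij_betw h (carrier_vec n1 :: bit vec set) {..<(2::nat) ^ (n2 - (n2 - n1))}"
      using finite_same_card_bij[OF finite_carrier_vec_bit finite_lessThan] by blast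
    then show ?thesis
      unfolding num_ordered_affine_partitions_def by (rule card_ordered_affine_partitions_reindex)
  qed
  finally show "card (construction_K n1 n2) =
      num_bent (n2 - n1) ^ (2 ^ n1) * num_ordered_affine_partitions n2 (n2 - n1)" .
qed

end
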